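(* Up to $\mathrm{Grz}$-equivalence there are exactly six $\mathrm{Grz}$-additive formulas without parameters (i.e. formulas in $\mathrm{Fm}(p)$): $\bot$, $p$, $\Diamond p$, $\top$, $\Diamond\Box p$, and $\Diamond\Box p\vee p$. Exactly five of them (all except $\top$) are normal in $\mathrm{Grz}$.
   Context: $\mathrm{Fm}(p)$ is the set of modal formulas (built with Boolean connectives, $\bot,\top,\Diamond,\Box$) containing no variables other than $p$. For a normal modal logic $\Lambda$, formulas $\varphi,\psi$ are $\Lambda$-equivalent if $\Lambda\vdash\varphi\leftrightarrow\psi$. A formula $\varphi(p)$ is $\Lambda$-additive if $\Lambda\vdash\varphi(p\vee q)\leftrightarrow\varphi(p)\vee\varphi(q)$ (with $q$ a variable distinct from $p$), and normal in $\Lambda$ if $\Lambda\vdash\varphi(\bot)\leftrightarrow\bot$. $\mathrm{Grz}$ is Grzegorczyk's logic, the normal modal logic $\mathrm{K}$ plus $\Box(\Box(p\to\Box p)\to p)\to p$; equivalently, the logic of all finite partially ordered (reflexive) frames. *)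

theory Defs
  imports Main
begin

datatype fm =
    Var nat
  | Bot
  | Top
  | Neg fm
  | And fm fm
  | Or fm fm
  | Imp fm fm
  | Dia fm
  | Box fm

definition Iff :: "fm \<Rightarrow> fm \<Rightarrow> fm" where
  "Iff \<phi> \<psi> = And (Imp \<phi> \<psi>) (Imp \<psi> \<phi>)"

primrec vars :: "fm \<Rightarrow> nat set" where
  "vars (Var x) = {x}"
| "vars Bot = {}"
| "vars Top = {}"
| "vars (Neg \<phi>) = vars \<phi>"
| "vars (And \<phi> \<psi>) = vars \<phi> \<union> vars \<psi>"
| "vars (Or \<phi> \<psi>) = vars \<phi> \<union> vars \<psi>"
| "vars (Imp \<phi> \<psi>) = vars \<phi> \<union> vars \<psi>"
| "vars (Dia \<phi>) = vars \<phi>"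
| "vars (Box \<phi>) = vars \<phi>"

definition Fm :: "nat \<Rightarrow> fm set" where
  "Fm p = {\<phi>. vars \<phi> \<subseteq> {p}}"

primrec subst :: "(nat \<Rightarrow> fm) \<Rightarrow> fm \<Rightarrow> fm" where
  "subst \<sigma> (Var x) = \<sigma> x"
| "subst \<sigma> Bot = Bot"
| "subst \<sigma> Top = Top"
| "subst \<sigma> (Neg \<phi>) = Neg (subst \<sigma> \<phi>)"
| "subst \<sigma> (And \<phi> \<psi>) = And (subst \<sigma> \<phi>) (subst \<sigma> \<psi>)"
| "subst \<sigma> (Or \<phi> \<psi>) = Or (subst \<sigma> \<phi>) (subst \<sigma> \<psi>)"
| "subst \<sigma> (Imp \<phi> \<psi>) = Imp (subst \<sigma> \<phi>) (subst \<sigma> \<psi>)"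
| "subst \<sigma> (Dia \<phi>) = Dia (subst \<sigma> \<phi>)"
| "subst \<sigma> (Box \<phi>) = Box (subst \<sigma> \<phi>)"

text \<open>Truth-functional evaluation: variables and formulas with a modal operator at the
  top are treated as atoms, whose truth values are given by \<open>v\<close>. Hence the tautologies
  below are the substitution instances of classical propositional tautologies.\<close>

primrec tf_eval :: "(fm \<Rightarrow> bool) \<Rightarrow> fm \<Rightarrow> bool" where
  "tf_eval v (Var x) = v (Var x)"
| "tf_eval v Bot = False"
| "tf_eval v Top = True"
| "tf_eval v (Neg \<phi>) = (\<not> tf_eval v \<phi>)"
| "tf_eval v (And \<phi> \<psi>) = (tf_eval v \<phi> \<and> tf_eval v \<psi>)"
| "tf_eval v (Or \<phi> \<psi>) = (tf_eval v \<phi> \<or> tf_eval v \<psi>)"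
| "tf_eval v (Imp \<phi> \<psi>) = (tf_eval v \<phi> \<longrightarrow> tf_eval v \<psi>)"
| "tf_eval v (Dia \<phi>) = v (Dia \<phi>)"
| "tf_eval v (Box \<phi>) = v (Box \<phi>)"

definition tautology :: "fm \<Rightarrow> bool" where
  "tautology \<phi> \<longleftrightarrow> (\<forall>v. tf_eval v \<phi>)"

text \<open>A logic is the set of its theorems. Both modal operators are primitive, so their
  duality is a clause of the definition.\<close>

definition normal_modal_logic :: "fm set \<Rightarrow> bool" where
  "normal_modal_logic L \<longleftrightarrow>
     (\<forall>\<phi>. tautology \<phi> \<longrightarrow> \<phi> \<in> L) \<and>
     (\<forall>\<phi> \<psi>. Imp (Box (Imp \<phi> \<psi>)) (Imp (Box \<phi>) (Box \<psi>)) \<in> L) \<and>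
     (\<forall>\<phi>. Iff (Dia \<phi>) (Neg (Box (Neg \<phi>))) \<in> L) \<and>
     (\<forall>\<phi> \<psi>. \<phi> \<in> L \<longrightarrow> Imp \<phi> \<psi> \<in> L \<longrightarrow> \<psi> \<in> L) \<and>
     (\<forall>\<phi>. \<phi> \<in> L \<longrightarrow> Box \<phi> \<in> L) \<and>
     (\<forall>\<phi> \<sigma>. \<phi> \<in> L \<longrightarrow> subst \<sigma> \<phi> \<in> L)"

text \<open>The normal modal logic K plus \<open>\<alpha>\<close>: the least normal modal logic containing \<open>\<alpha>\<close>.\<close>

definition K_plus :: "fm \<Rightarrow> fm set" where
  "K_plus \<alpha> = \<Inter> {L. normal_modal_logic L \<and> \<alpha> \<in> L}"

definition Grz :: "fm set" where
  "Grz = K_plus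
     (let p = Var 0 in Imp (Box (Imp (Box (Imp p (Box p))) p)) p)"

definition equivalent :: "fm set \<Rightarrow> fm \<Rightarrow> fm \<Rightarrow> bool" where
  "equivalent L \<phi> \<psi> \<longleftrightarrow> Iff \<phi> \<psi> \<in> L"

text \<open>In \<open>app p \<phi> \<psi>\<close>, the formula \<open>\<phi>\<close> is regarded as \<open>\<phi>(p)\<close>; the result is \<open>\<phi>(\<psi>)\<close>.\<close>

definition app :: "nat \<Rightarrow> fm \<Rightarrow> fm \<Rightarrow> fm" where
  "app p \<phi> \<psi> = subst (Var(p := \<psi>)) \<phi>"

text \<open>Here \<open>q\<close> is meant to be a variable distinct from \<open>p\<close> and not occurring in \<open>\<phi>\<close>.\<close>

definition additive :: "fm set \<Rightarrow> nat \<Rightarrow> nat \<Rightarrow> fm \<Rightarrow> bool" where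
  "additive L p q \<phi> \<longleftrightarrow>
     equivalent L (app p \<phi> (Or (Var p) (Var q))) (Or (app p \<phi> (Var p)) (app p \<phi> (Var q)))"

definition normal_in :: "fm set \<Rightarrow> nat \<Rightarrow> fm \<Rightarrow> bool" where
  "normal_in L p \<phi> \<longleftrightarrow> equivalent L (app p \<phi> Bot) Bot"

definition six_formulas :: "nat \<Rightarrow> fm set" where
  "six_formulas p =
     {Bot, Var p, Dia (Var p), Top, Dia (Box (Var p)), Or (Dia (Box (Var p))) (Var p)}"

end

theory Submission
  imports Defs "HOL-Library.Sublist" "HOL-Combinatorics.Transposition"
begin

text \<open>Grz is the logic of the full finite trees, refuted formulas failing at the root. On a finite
  tree an additive formula with \<open>\<phi>(\<bottom>)\<close> false is determined by the nodes \<open>y\<close> for which it holds at the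
  root when \<open>p\<close> is true exactly at \<open>y\<close>. Automorphisms of the full tree act transitively on each level,
  so by additivity \<open>y\<close> may be replaced by its whole level, and the levels below, at and above that of
  \<open>y\<close> collapse to a chain with at most three points. Only four truth values on such chains remain, and
  additivity on the three-element chain leaves just six possible combinations of them.\<close>

section \<open>Kripke semantics\<close>

text \<open>Grz is not canonical, so completeness cuts maximal theories down to a finite set of
  formulas, and the order on these traces has to be forced to be antisymmetric. Finite posets would
  already characterise Grz, but two points of a poset need not look alike even at equal height.
  Unravelling into full trees supplies the symmetry. As all leaves of a full tree have the same
  depth, the depth of a node also determines what lies above it, which makes suitable monotone
  regroupings of depths bounded morphisms onto chains. The case of \<phi>(\<bottom>) true causes no
  mixture: \<phi>(\<bottom>) has no variables and every full tree collapses onto one reflexive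
  point, so \<phi>(\<bottom>) holds at all roots or at none. In the former case monotonicity of
  additive formulas makes \<phi> true at all roots. The count six arises as 1 + 1 + 4. One case is
  \<phi>(\<bottom>) true. Otherwise, merging the middle of the three-element chain with either
  neighbour shows that the value at the middle implies both values on the two-element chain: one
  case with the middle true, four with it false.\<close>

primrec sat :: "'w set \<Rightarrow> ('w \<Rightarrow> 'w \<Rightarrow> bool) \<Rightarrow> (nat \<Rightarrow> 'w \<Rightarrow> bool) \<Rightarrow> 'w \<Rightarrow> fm \<Rightarrow> bool" where
  "sat W R V x (Var u) = V u x"
| "sat W R V x Bot = False"
| "sat W R V x Top = True"
| "sat W R V x (Neg \<phi>) = (\<not> sat W R V x \<phi>)"
| "sat W R V x (And \<phi> \<psi>) = (sat W R V x \<phi> \<and> sat W R V x \<psi>)"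
| "sat W R V x (Or \<phi> \<psi>) = (sat W R V x \<phi> \<or> sat W R V x \<psi>)"
| "sat W R V x (Imp \<phi> \<psi>) = (sat W R V x \<phi> \<longrightarrow> sat W R V x \<psi>)"
| "sat W R V x (Dia \<phi>) = (\<exists>y\<in>W. R x y \<and> sat W R V y \<phi>)"
| "sat W R V x (Box \<phi>) = (\<forall>y\<in>W. R x y \<longrightarrow> sat W R V y \<phi>)"

lemma sat_Iff [simp]: "sat W R V x (Iff \<phi> \<psi>) \<longleftrightarrow> (sat W R V x \<phi> \<longleftrightarrow> sat W R V x \<psi>)"
  by (auto simp: Iff_def)

lemma sat_subst: "sat W R V x (subst \<sigma> \<phi>) \<longleftrightarrow> sat W R (\<lambda>u y. sat W R V y (\<sigma> u)) x \<phi>"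
  by (induction \<phi> arbitrary: x) auto

lemma sat_cong_vars:
  "(\<And>u y. u \<in> vars \<phi> \<Longrightarrow> V u y \<longleftrightarrow> V' u y) \<Longrightarrow> sat W R V x \<phi> \<longleftrightarrow> sat W R V' x \<phi>"
proof (induction \<phi> arbitrary: x)
  case (Dia \<phi>)
  then show ?case by (metis sat.simps(8) vars.simps(8))
next
  case (Box \<phi>)
  then show ?case by (metis sat.simps(9) vars.simps(9))
qed (auto; metis)+

lemma sat_app:
  assumes "\<phi> \<in> Fm p"
  shows "sat W R V x (app p \<phi> \<psi>) \<longleftrightarrow> sat W R (\<lambda>_ y. sat W R V y \<psi>) x \<phi>"
  unfolding app_def sat_subst using assms
  by (intro sat_cong_vars) (auto simp: Fm_def)

lemma sat_tautology:
  assumes "tautology \<phi>"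
  shows "sat W R V x \<phi>"
proof -
  have "tf_eval (sat W R V x) \<psi> = sat W R V x \<psi>" for \<psi>
    by (induction \<psi>) auto
  then show ?thesis using assms by (auto simp: tautology_def)
qed

definition bounded_morphism ::
    "('v \<Rightarrow> 'w) \<Rightarrow> 'v set \<Rightarrow> ('v \<Rightarrow> 'v \<Rightarrow> bool) \<Rightarrow> 'w set \<Rightarrow> ('w \<Rightarrow> 'w \<Rightarrow> bool) \<Rightarrow> bool" where
  "bounded_morphism f W R W' R' \<longleftrightarrow>
     f ` W \<subseteq> W' \<and>
     (\<forall>x\<in>W. \<forall>y\<in>W. R x y \<longrightarrow> R' (f x) (f y)) \<and>
     (\<forall>x\<in>W. \<forall>y'\<in>W'. R' (f x) y' \<longrightarrow> (\<exists>y\<in>W. R x y \<and> f y = y'))"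

lemma sat_bounded_morphism:
  assumes f: "bounded_morphism f W R W' R'"
    and V: "\<And>u x. x \<in> W \<Longrightarrow> V u x \<longleftrightarrow> V' u (f x)"
    and "x \<in> W"
  shows "sat W R V x \<phi> \<longleftrightarrow> sat W' R' V' (f x) \<phi>"
  using \<open>x \<in> W\<close>
proof (induction \<phi> arbitrary: x)
  case (Dia \<phi>)
  then show ?case using f unfolding bounded_morphism_def sat.simps
    by (metis image_subset_iff)
next
  case (Box \<phi>)
  then show ?case using f unfolding bounded_morphism_def sat.simps
    by (metis image_subset_iff)
qed (auto simp: V)


section \<open>Full finite trees and soundness\<close>

text \<open>A node is encoded as the path from the root to it, so accessibility is
  \<open>prefix\<close> and depth is \<open>length\<close>.\<close>

definition tree :: "nat \<Rightarrow> nat \<Rightarrow> nat list set" where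
  "tree n d = {xs. set xs \<subseteq> {..<n} \<and> length xs \<le> d}"

lemma Nil_in_tree [simp]: "[] \<in> tree n d"
  by (simp add: tree_def)

lemma finite_tree: "finite (tree n d)"
  unfolding tree_def by (rule finite_lists_length_le) simp

text \<open>Validity is required at all nodes, not only at the root, since necessitation does not
  preserve truth at a single node.\<close>

lemma normal_modal_logic_tree:
  "normal_modal_logic {\<phi>. \<forall>V. \<forall>x\<in>tree n d. sat (tree n d) prefix V x \<phi>}"
  unfolding normal_modal_logic_def
  by (intro conjI allI impI CollectI ballI; simp add: sat_tautology sat_subst)

text \<open>Among the nodes above \<open>x\<close> that refute \<open>p\<close>, take a longest one
  \<open>y\<close>. Strictly above \<open>y\<close> the formula holds, so
  \<open>Imp p (Box p)\<close> holds at all nodes above \<open>y\<close>, and the premise then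
  forces \<open>p\<close> at \<open>y\<close>.\<close>

lemma tree_Grz_axiom:
  assumes x: "x \<in> tree n d"
  shows "sat (tree n d) prefix V x (Imp (Box (Imp (Box (Imp p (Box p))) p)) p)"
proof (rule ccontr)
  let ?s = "sat (tree n d) prefix V"
  assume "\<not> ?thesis"
  then have box: "\<And>y. y \<in> tree n d \<Longrightarrow> prefix x y \<Longrightarrow> ?s y (Box (Imp p (Box p))) \<Longrightarrow> ?s y p"
    and np: "\<not> ?s x p" unfolding sat.simps(7,9) by blast+
  let ?P = "\<lambda>y. y \<in> tree n d \<and> prefix x y \<and> \<not> ?s y p"
  have "\<exists>y. ?P y \<and> (\<forall>z. ?P z \<longrightarrow> length z \<le> length y)"
    using x np by (intro ex_has_greatest_nat[of ?P x length "Suc d"]) (auto simp: tree_def)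
  then obtain y where y: "?P y" and ymax: "\<And>z. ?P z \<Longrightarrow> length z \<le> length y" by blast
  have above: "?s z p" if "z \<in> tree n d" "prefix y z" "z \<noteq> y" for z
  proof (rule ccontr)
    assume "\<not> ?s z p"
    moreover have "prefix x z" using that y by (meson prefix_order.order_trans)
    ultimately have "length z \<le> length y" using ymax that by blast
    then show False using that by (auto simp: prefix_def)
  qed
  have "?s z (Box p)" if "z \<in> tree n d" "prefix y z" "?s z p" for z
  proof -
    have "z \<noteq> y" using y that by blast
    then have "?s v p" if "v \<in> tree n d" "prefix z v" for v
      using above[OF that(1)] \<open>prefix y z\<close> that(2)
      by (metis prefix_order.antisym prefix_order.order_trans)
    then show ?thesis by simp
  qed
  then have "?s y (Box (Imp p (Box p)))" by simp
  then show False using box y by blast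
qed

lemma Grz_subset:
  assumes "normal_modal_logic L" and "\<And>p. Imp (Box (Imp (Box (Imp p (Box p))) p)) p \<in> L"
  shows "Grz \<subseteq> L"
  using assms unfolding Grz_def K_plus_def Let_def by blast

lemma Grz_sound:
  assumes "\<phi> \<in> Grz" and "x \<in> tree n d"
  shows "sat (tree n d) prefix V x \<phi>"
  using Grz_subset[OF normal_modal_logic_tree[of n d]] tree_Grz_axiom assms by blast


section \<open>Maximal theories\<close>

lemma normal_modal_logic_Inter:
  assumes "\<And>L. L \<in> A \<Longrightarrow> normal_modal_logic L"
  shows "normal_modal_logic (\<Inter>A)"
  using assms unfolding normal_modal_logic_def Inter_iff
  by (intro conjI allI impI ballI) (meson | simp)+

lemma normal_modal_logic_Grz: "normal_modal_logic Grz"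
  unfolding Grz_def K_plus_def by (rule normal_modal_logic_Inter) simp

lemma Grz_axiom: "Imp (Box (Imp (Box (Imp \<phi> (Box \<phi>))) \<phi>)) \<phi> \<in> Grz"
proof -
  let ?\<alpha> = "Imp (Box (Imp (Box (Imp (Var 0) (Box (Var 0)))) (Var 0))) (Var 0)"
  have "?\<alpha> \<in> Grz" by (auto simp: Grz_def K_plus_def Let_def)
  then have "subst (\<lambda>_. \<phi>) ?\<alpha> \<in> Grz"
    using normal_modal_logic_Grz unfolding normal_modal_logic_def by blast
  then show ?thesis by simp
qed

text \<open>Closure under necessitation is deliberately absent: a theory collects what is true at
  one world.\<close>

definition closed_theory :: "fm set \<Rightarrow> fm set \<Rightarrow> bool" where
  "closed_theory L \<Gamma> \<longleftrightarrow> L \<subseteq> \<Gamma> \<and> (\<forall>\<phi> \<psi>. \<phi> \<in> \<Gamma> \<longrightarrow> Imp \<phi> \<psi> \<in> \<Gamma> \<longrightarrow> \<psi> \<in> \<Gamma>)"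

text \<open>The equivalence expresses consistency and completeness at once.\<close>

definition maximal_theory :: "fm set \<Rightarrow> fm set \<Rightarrow> bool" where
  "maximal_theory L \<Gamma> \<longleftrightarrow> closed_theory L \<Gamma> \<and> (\<forall>\<phi>. Neg \<phi> \<in> \<Gamma> \<longleftrightarrow> \<phi> \<notin> \<Gamma>)"

context
  fixes L :: "fm set"
  assumes L: "normal_modal_logic L"
begin

lemma closed_theory_logic: "closed_theory L L"
  using L unfolding closed_theory_def normal_modal_logic_def by blast

lemma closed_theory_tautology: "closed_theory L \<Gamma> \<Longrightarrow> tautology \<phi> \<Longrightarrow> \<phi> \<in> \<Gamma>"
  using L unfolding closed_theory_def normal_modal_logic_def by blast

lemma closed_theory_mp: "closed_theory L \<Gamma> \<Longrightarrow> Imp \<phi> \<psi> \<in> \<Gamma> \<Longrightarrow> \<phi> \<in> \<Gamma> \<Longrightarrow> \<psi> \<in> \<Gamma>"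
  unfolding closed_theory_def by blast

lemma closed_theory_mp_tautology:
  "closed_theory L \<Gamma> \<Longrightarrow> tautology (Imp \<phi> \<psi>) \<Longrightarrow> \<phi> \<in> \<Gamma> \<Longrightarrow> \<psi> \<in> \<Gamma>"
  using closed_theory_mp closed_theory_tautology by blast

lemma closed_theory_mp2_tautology:
  "closed_theory L \<Gamma> \<Longrightarrow> tautology (Imp \<phi> (Imp \<psi> \<chi>)) \<Longrightarrow> \<phi> \<in> \<Gamma> \<Longrightarrow> \<psi> \<in> \<Gamma> \<Longrightarrow> \<chi> \<in> \<Gamma>"
  using closed_theory_mp closed_theory_tautology by blast

text \<open>This is the theory generated by \<Gamma> and \<psi>; the lemma plays the part of the
  deduction theorem, with no notion of derivation.\<close>

lemma closed_theory_extend: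
  assumes \<Gamma>: "closed_theory L \<Gamma>"
  shows "closed_theory L {\<chi>. Imp \<psi> \<chi> \<in> \<Gamma>}"
  unfolding closed_theory_def
proof (intro conjI subsetI allI impI; clarify?)
  fix \<chi> assume "\<chi> \<in> L"
  then have "\<chi> \<in> \<Gamma>" using \<Gamma> by (auto simp: closed_theory_def)
  then show "Imp \<psi> \<chi> \<in> \<Gamma>"
    by (rule closed_theory_mp_tautology[OF \<Gamma>, rotated]) (simp add: tautology_def)
next
  fix \<chi> \<theta> assume "Imp \<psi> \<chi> \<in> \<Gamma>" "Imp \<psi> (Imp \<chi> \<theta>) \<in> \<Gamma>"
  then show "Imp \<psi> \<theta> \<in> \<Gamma>"
    by (rule closed_theory_mp2_tautology[OF \<Gamma>, rotated]) (simp add: tautology_def)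
qed

text \<open>Zorn's lemma is applied to the theories omitting \<phi>. If a maximal such theory lacks
  \<psi>, its extension by \<psi> contains \<phi>, so it contains \<open>Imp \<psi> \<phi>\<close>.
  Lacking both \<psi> and \<open>Neg \<psi>\<close> would thus yield \<phi> by a case
  distinction.\<close>

lemma lindenbaum:
  assumes \<Gamma>: "closed_theory L \<Gamma>" and \<phi>: "\<phi> \<notin> \<Gamma>"
  obtains \<Delta> where "maximal_theory L \<Delta>" "\<Gamma> \<subseteq> \<Delta>" "\<phi> \<notin> \<Delta>"
proof -
  let ?A = "{\<Delta>. closed_theory L \<Delta> \<and> \<Gamma> \<subseteq> \<Delta> \<and> \<phi> \<notin> \<Delta>}"
  have "\<exists>M\<in>?A. \<forall>X\<in>?A. M \<subseteq> X \<longrightarrow> X = M"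
  proof (rule subset_Zorn_nonempty)
    show "?A \<noteq> {}" using \<Gamma> \<phi> by blast
  next
    fix C assume C: "C \<noteq> {}" "subset.chain ?A C"
    then have sub: "C \<subseteq> ?A" and lin: "\<And>X Y. X \<in> C \<Longrightarrow> Y \<in> C \<Longrightarrow> X \<subseteq> Y \<or> Y \<subseteq> X"
      by (auto simp: subset_chain_def)
    have "closed_theory L (\<Union>C)"
      unfolding closed_theory_def
    proof (intro conjI allI impI)
      show "L \<subseteq> \<Union>C" using sub C(1) by (fastforce simp: closed_theory_def)
    next
      fix \<phi> \<psi> assume "\<phi> \<in> \<Union>C" "Imp \<phi> \<psi> \<in> \<Union>C"
      then obtain X Y where "X \<in> C" "Y \<in> C" "\<phi> \<in> X" "Imp \<phi> \<psi> \<in> Y" by blast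
      with lin obtain Z where "Z \<in> C" "\<phi> \<in> Z" "Imp \<phi> \<psi> \<in> Z" by blast
      then show "\<psi> \<in> \<Union>C" using sub closed_theory_mp by blast
    qed
    then show "\<Union>C \<in> ?A" using sub C(1) by blast
  qed
  then obtain \<Delta> where \<Delta>': "\<Delta> \<in> ?A" and max': "\<forall>X\<in>?A. \<Delta> \<subseteq> X \<longrightarrow> X = \<Delta>" by blast
  from \<Delta>' have \<Delta>: "closed_theory L \<Delta>" "\<Gamma> \<subseteq> \<Delta>" "\<phi> \<notin> \<Delta>" by auto
  have max: "X = \<Delta>" if "closed_theory L X" "\<phi> \<notin> X" "\<Delta> \<subseteq> X" for X
  proof -
    have "X \<in> ?A" using that \<Delta>(2) by auto
    then show ?thesis using max' that(3) by blast
  qed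
  have ext: "Imp \<psi> \<phi> \<in> \<Delta>" if "\<psi> \<notin> \<Delta>" for \<psi>
  proof (rule ccontr)
    let ?X = "{\<chi>. Imp \<psi> \<chi> \<in> \<Delta>}"
    assume "Imp \<psi> \<phi> \<notin> \<Delta>"
    moreover have "\<Delta> \<subseteq> ?X"
    proof
      fix \<chi> assume "\<chi> \<in> \<Delta>"
      then have "Imp \<psi> \<chi> \<in> \<Delta>"
        by (rule closed_theory_mp_tautology[OF \<Delta>(1), rotated]) (simp add: tautology_def)
      then show "\<chi> \<in> ?X" by simp
    qed
    ultimately have "?X = \<Delta>" using max closed_theory_extend[OF \<Delta>(1)] by blast
    moreover have "\<psi> \<in> ?X"
      using closed_theory_tautology[OF \<Delta>(1)] by (simp add: tautology_def)
    ultimately show False using that by blast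
  qed
  have "Neg \<psi> \<in> \<Delta> \<longleftrightarrow> \<psi> \<notin> \<Delta>" for \<psi>
  proof
    assume "Neg \<psi> \<in> \<Delta>"
    then show "\<psi> \<notin> \<Delta>"
      using closed_theory_mp2_tautology[OF \<Delta>(1), of "Neg \<psi>" \<psi> \<phi>] \<Delta>(3)
      by (simp add: tautology_def) blast
  next
    assume "\<psi> \<notin> \<Delta>"
    then show "Neg \<psi> \<in> \<Delta>"
      using closed_theory_mp2_tautology[OF \<Delta>(1), of "Imp \<psi> \<phi>" "Imp (Neg \<psi>) \<phi>" \<phi>] \<Delta>(3)
        ext[of \<psi>] ext[of "Neg \<psi>"]
      by (simp add: tautology_def) blast
  qed
  then show thesis using that \<Delta> by (auto simp: maximal_theory_def)
qed

lemma maximal_theory_logic: "maximal_theory L \<Delta> \<Longrightarrow> \<phi> \<in> L \<Longrightarrow> \<phi> \<in> \<Delta>"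
  by (auto simp: maximal_theory_def closed_theory_def)

text \<open>With this, derivations in the logic are replaced by Boolean reasoning about membership
  in an arbitrary maximal theory.\<close>

lemma in_logic_iff: "\<phi> \<in> L \<longleftrightarrow> (\<forall>\<Delta>. maximal_theory L \<Delta> \<longrightarrow> \<phi> \<in> \<Delta>)"
proof
  assume "\<phi> \<in> L"
  then show "\<forall>\<Delta>. maximal_theory L \<Delta> \<longrightarrow> \<phi> \<in> \<Delta>"
    by (auto simp: maximal_theory_def closed_theory_def)
next
  assume "\<forall>\<Delta>. maximal_theory L \<Delta> \<longrightarrow> \<phi> \<in> \<Delta>"
  then show "\<phi> \<in> L" using lindenbaum[OF closed_theory_logic] by blast
qed

lemma maximal_theory_tf_eval:
  assumes \<Delta>: "maximal_theory L \<Delta>"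
  shows "tf_eval (\<lambda>\<psi>. \<psi> \<in> \<Delta>) \<phi> \<longleftrightarrow> \<phi> \<in> \<Delta>"
proof -
  have closed: "closed_theory L \<Delta>" and neg: "\<And>\<phi>. Neg \<phi> \<in> \<Delta> \<longleftrightarrow> \<phi> \<notin> \<Delta>"
    using \<Delta> by (auto simp: maximal_theory_def)
  note t = closed_theory_tautology[OF closed]
    and t1 = closed_theory_mp_tautology[OF closed]
    and t2 = closed_theory_mp2_tautology[OF closed]
  show ?thesis
  proof (induction \<phi>)
    case Bot
    have "Neg Bot \<in> \<Delta>" by (rule t) (simp add: tautology_def)
    then show ?case using neg by auto
  next
    case Top
    then show ?case using t by (simp add: tautology_def)
  next
    case (And \<phi> \<psi>)
    have "tautology (Imp (And \<phi> \<psi>) \<phi>)" "tautology (Imp (And \<phi> \<psi>) \<psi>)"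
      "tautology (Imp \<phi> (Imp \<psi> (And \<phi> \<psi>)))"
      by (simp_all add: tautology_def)
    then show ?case using And t1 t2 unfolding tf_eval.simps by metis
  next
    case (Or \<phi> \<psi>)
    have "tautology (Imp \<phi> (Or \<phi> \<psi>))" "tautology (Imp \<psi> (Or \<phi> \<psi>))"
      "tautology (Imp (Or \<phi> \<psi>) (Imp (Neg \<phi>) \<psi>))"
      by (simp_all add: tautology_def)
    then show ?case using Or t1 t2 neg unfolding tf_eval.simps by metis
  next
    case (Imp \<phi> \<psi>)
    \<comment> \<open>The last, trivial tautology turns \<open>t2\<close> into modus ponens inside
      \<Delta>.\<close>
    have "tautology (Imp \<psi> (Imp \<phi> \<psi>))" "tautology (Imp (Neg \<phi>) (Imp \<phi> \<psi>))"
      "tautology (Imp (Imp \<phi> \<psi>) (Imp \<phi> \<psi>))"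
      by (simp_all add: tautology_def)
    then show ?case using Imp t1 t2 neg unfolding tf_eval.simps by metis
  qed (simp_all add: neg)
qed

context
  fixes \<Delta> :: "fm set"
  assumes \<Delta>: "maximal_theory L \<Delta>"
begin

lemma maximal_theory_simps:
  "Bot \<notin> \<Delta>"
  "Top \<in> \<Delta>"
  "Neg \<phi> \<in> \<Delta> \<longleftrightarrow> \<phi> \<notin> \<Delta>"
  "And \<phi> \<psi> \<in> \<Delta> \<longleftrightarrow> \<phi> \<in> \<Delta> \<and> \<psi> \<in> \<Delta>"
  "Or \<phi> \<psi> \<in> \<Delta> \<longleftrightarrow> \<phi> \<in> \<Delta> \<or> \<psi> \<in> \<Delta>"
  "Imp \<phi> \<psi> \<in> \<Delta> \<longleftrightarrow> (\<phi> \<in> \<Delta> \<longrightarrow> \<psi> \<in> \<Delta>)"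
  "Dia \<phi> \<in> \<Delta> \<longleftrightarrow> Box (Neg \<phi>) \<notin> \<Delta>"
proof -
  note e = maximal_theory_tf_eval[OF \<Delta>]
  show "Bot \<notin> \<Delta>" "Top \<in> \<Delta>" "Neg \<phi> \<in> \<Delta> \<longleftrightarrow> \<phi> \<notin> \<Delta>"
    "And \<phi> \<psi> \<in> \<Delta> \<longleftrightarrow> \<phi> \<in> \<Delta> \<and> \<psi> \<in> \<Delta>" "Or \<phi> \<psi> \<in> \<Delta> \<longleftrightarrow> \<phi> \<in> \<Delta> \<or> \<psi> \<in> \<Delta>"
    "Imp \<phi> \<psi> \<in> \<Delta> \<longleftrightarrow> (\<phi> \<in> \<Delta> \<longrightarrow> \<psi> \<in> \<Delta>)"
    using e[of \<phi>] e[of \<psi>] e[of Bot] e[of Top] e[of "Neg \<phi>"] e[of "And \<phi> \<psi>"] e[of "Or \<phi> \<psi>"]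
      e[of "Imp \<phi> \<psi>"] by simp_all
  have "Iff (Dia \<phi>) (Neg (Box (Neg \<phi>))) \<in> L"
    using L by (simp add: normal_modal_logic_def)
  then have "Iff (Dia \<phi>) (Neg (Box (Neg \<phi>))) \<in> \<Delta>" by (rule maximal_theory_logic[OF \<Delta>])
  then show "Dia \<phi> \<in> \<Delta> \<longleftrightarrow> Box (Neg \<phi>) \<notin> \<Delta>"
    using e[of "Iff (Dia \<phi>) (Neg (Box (Neg \<phi>)))"] by (simp add: Iff_def) blast
qed

lemma maximal_theory_K: "Box (Imp \<phi> \<psi>) \<in> \<Delta> \<Longrightarrow> Box \<phi> \<in> \<Delta> \<Longrightarrow> Box \<psi> \<in> \<Delta>"
proof -
  have "Imp (Box (Imp \<phi> \<psi>)) (Imp (Box \<phi>) (Box \<psi>)) \<in> L"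
    using L by (simp add: normal_modal_logic_def)
  then have "Imp (Box (Imp \<phi> \<psi>)) (Imp (Box \<phi>) (Box \<psi>)) \<in> \<Delta>"
    by (rule maximal_theory_logic[OF \<Delta>])
  then show "Box (Imp \<phi> \<psi>) \<in> \<Delta> \<Longrightarrow> Box \<phi> \<in> \<Delta> \<Longrightarrow> Box \<psi> \<in> \<Delta>"
    by (simp add: maximal_theory_simps)
qed

lemma maximal_theory_Box_logic: "\<phi> \<in> L \<Longrightarrow> Box \<phi> \<in> \<Delta>"
proof -
  assume "\<phi> \<in> L"
  then have "Box \<phi> \<in> L" using L unfolding normal_modal_logic_def by blast
  then show "Box \<phi> \<in> \<Delta>" by (rule maximal_theory_logic[OF \<Delta>])
qed

end

text \<open>By \<open>in_logic_iff\<close>, the assumption \<open>imp\<close> makes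
  \<open>Imp \<phi> \<psi>\<close> a theorem, which may be boxed and distributed by K.\<close>

lemma maximal_theory_Box_mono:
  assumes \<Delta>: "maximal_theory L \<Delta>" and "Box \<phi> \<in> \<Delta>"
    and imp: "\<And>\<Gamma>. maximal_theory L \<Gamma> \<Longrightarrow> \<phi> \<in> \<Gamma> \<Longrightarrow> \<psi> \<in> \<Gamma>"
  shows "Box \<psi> \<in> \<Delta>"
proof -
  have "Imp \<phi> \<psi> \<in> L" using imp by (auto simp: in_logic_iff maximal_theory_simps)
  then show ?thesis
    using maximal_theory_K maximal_theory_Box_logic \<Delta> \<open>Box \<phi> \<in> \<Delta>\<close> by blast
qed

lemma maximal_theory_Box_mono2:
  assumes \<Delta>: "maximal_theory L \<Delta>" and "Box \<phi> \<in> \<Delta>" and "Box \<psi> \<in> \<Delta>"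
    and imp: "\<And>\<Gamma>. maximal_theory L \<Gamma> \<Longrightarrow> \<phi> \<in> \<Gamma> \<Longrightarrow> \<psi> \<in> \<Gamma> \<Longrightarrow> \<chi> \<in> \<Gamma>"
  shows "Box \<chi> \<in> \<Delta>"
proof -
  have "Box (Imp \<psi> \<chi>) \<in> \<Delta>"
    using \<Delta> \<open>Box \<phi> \<in> \<Delta>\<close>
    by (rule maximal_theory_Box_mono) (simp add: maximal_theory_simps imp)
  then show ?thesis using maximal_theory_K \<Delta> \<open>Box \<psi> \<in> \<Delta>\<close> by blast
qed

end


section \<open>Maximal theories of Grz\<close>

lemmas Grz_simps = maximal_theory_simps[OF normal_modal_logic_Grz]
lemmas Grz_Box_mono = maximal_theory_Box_mono[OF normal_modal_logic_Grz]
lemmas Grz_Box_mono2 = maximal_theory_Box_mono2[OF normal_modal_logic_Grz]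

lemma Grz_rule:
  assumes "maximal_theory Grz \<Delta>" and "Box (Imp (Box (Imp \<phi> (Box \<phi>))) \<phi>) \<in> \<Delta>"
  shows "\<phi> \<in> \<Delta>"
proof -
  have "Imp (Box (Imp (Box (Imp \<phi> (Box \<phi>))) \<phi>)) \<phi> \<in> \<Delta>"
    by (rule maximal_theory_logic[OF normal_modal_logic_Grz assms(1) Grz_axiom])
  then show ?thesis using assms by (simp add: Grz_simps)
qed

text \<open>\<phi> implies every implication with conclusion \<phi>, so \<open>Box \<phi>\<close>
  already gives the antecedent of the Grz axiom.\<close>

lemma Grz_T:
  assumes \<Delta>: "maximal_theory Grz \<Delta>" and "Box \<phi> \<in> \<Delta>"
  shows "\<phi> \<in> \<Delta>"
  by (rule Grz_rule[OF \<Delta>]) (rule Grz_Box_mono[OF assms], simp add: Grz_simps)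

text \<open>The instance of the axiom for \<open>\<phi> \<and> (\<box>\<phi> \<longrightarrow> \<box>\<box>\<phi>)\<close> yields transitivity.\<close>

lemma Grz_4:
  assumes \<Delta>: "maximal_theory Grz \<Delta>" and \<phi>: "Box \<phi> \<in> \<Delta>"
  shows "Box (Box \<phi>) \<in> \<Delta>"
proof -
  define \<psi> where "\<psi> = And \<phi> (Imp (Box \<phi>) (Box (Box \<phi>)))"
  \<comment> \<open>If \<psi> holds, then so does \<open>Box \<psi>\<close>, hence
    \<open>Box \<phi>\<close>. If \<psi> fails although \<phi> holds, its second conjunct fails, and
    the antecedent of that conjunct is \<open>Box \<phi>\<close>. Boxing this claim gives the second
    conjunct of \<psi> in claim 2.\<close>
  have 1: "Box \<phi> \<in> \<Gamma>"
    if \<Gamma>: "maximal_theory Grz \<Gamma>" and "\<phi> \<in> \<Gamma>" "Imp \<psi> (Box \<psi>) \<in> \<Gamma>" for \<Gamma>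
  proof (cases "\<psi> \<in> \<Gamma>")
    case True
    then have "Box \<psi> \<in> \<Gamma>" using that by (simp add: Grz_simps)
    then show ?thesis by (rule Grz_Box_mono[OF \<Gamma>]) (simp add: \<psi>_def Grz_simps)
  next
    case False
    then show ?thesis using that by (simp add: \<psi>_def Grz_simps)
  qed
  have 2: "\<psi> \<in> \<Gamma>"
    if \<Gamma>: "maximal_theory Grz \<Gamma>" and "\<phi> \<in> \<Gamma>" and i: "Box (Imp \<psi> (Box \<psi>)) \<in> \<Gamma>" for \<Gamma>
  proof -
    have "Box (Box \<phi>) \<in> \<Gamma>" if "Box \<phi> \<in> \<Gamma>"
      using Grz_Box_mono2[OF \<Gamma> that i] 1 by blast
    then show ?thesis using \<Gamma> \<open>\<phi> \<in> \<Gamma>\<close> unfolding \<psi>_def by (simp add: Grz_simps)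
  qed
  have "Box (Imp (Box (Imp \<psi> (Box \<psi>))) \<psi>) \<in> \<Delta>"
    by (rule Grz_Box_mono[OF \<Delta> \<phi>]) (simp add: Grz_simps 2)
  then have "\<psi> \<in> \<Delta>" by (rule Grz_rule[OF \<Delta>])
  then show ?thesis using \<Delta> \<phi> by (simp add: \<psi>_def Grz_simps)
qed

text \<open>The Grz axiom read contrapositively: a failure of \<open>Box \<phi>\<close> is witnessed
  by a world refuting \<phi> above which \<phi> persists once it holds. If the theory generated by
  the boxed part of \<Delta> together with \<open>Box (Imp \<phi> (Box \<phi>))\<close> contained
  \<phi>, transitivity and the axiom under a box would put \<open>Box \<phi>\<close> into
  \<Delta>.\<close>

lemma Grz_successor:
  assumes \<Delta>: "maximal_theory Grz \<Delta>" and \<phi>: "Box \<phi> \<notin> \<Delta>"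
  obtains \<Gamma> where "maximal_theory Grz \<Gamma>" "\<phi> \<notin> \<Gamma>" "Box (Imp \<phi> (Box \<phi>)) \<in> \<Gamma>"
    "\<And>\<psi>. Box \<psi> \<in> \<Delta> \<Longrightarrow> Box \<psi> \<in> \<Gamma>"
proof -
  let ?\<alpha> = "Box (Imp \<phi> (Box \<phi>))"
  let ?\<Gamma> = "{\<psi>. Box (Imp ?\<alpha> \<psi>) \<in> \<Delta>}"
  have "closed_theory Grz ?\<Gamma>"
    unfolding closed_theory_def
  proof (intro conjI subsetI allI impI; clarify?)
    fix \<psi> assume "\<psi> \<in> Grz"
    then have "Imp ?\<alpha> \<psi> \<in> Grz"
      by (auto simp: in_logic_iff[OF normal_modal_logic_Grz] Grz_simps)
    then show "Box (Imp ?\<alpha> \<psi>) \<in> \<Delta>"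
      by (rule maximal_theory_Box_logic[OF normal_modal_logic_Grz \<Delta>])
  next
    fix \<psi> \<chi> assume "Box (Imp ?\<alpha> \<psi>) \<in> \<Delta>" "Box (Imp ?\<alpha> (Imp \<psi> \<chi>)) \<in> \<Delta>"
    then show "Box (Imp ?\<alpha> \<chi>) \<in> \<Delta>"
      by (rule Grz_Box_mono2[OF \<Delta>]) (simp add: Grz_simps)
  qed
  moreover have "\<phi> \<notin> ?\<Gamma>"
  proof
    assume "\<phi> \<in> ?\<Gamma>"
    then have "Box (Box (Imp ?\<alpha> \<phi>)) \<in> \<Delta>" using Grz_4[OF \<Delta>] by simp
    then have "Box \<phi> \<in> \<Delta>" by (rule Grz_Box_mono[OF \<Delta>]) (rule Grz_rule)
    then show False using \<phi> by simp
  qed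
  ultimately obtain \<Gamma> where \<Gamma>: "maximal_theory Grz \<Gamma>" "?\<Gamma> \<subseteq> \<Gamma>" "\<phi> \<notin> \<Gamma>"
    using lindenbaum[OF normal_modal_logic_Grz] by blast
  show thesis
  proof (rule that[OF \<Gamma>(1,3)])
    have "Imp ?\<alpha> ?\<alpha> \<in> Grz" by (auto simp: in_logic_iff[OF normal_modal_logic_Grz] Grz_simps)
    then have "?\<alpha> \<in> ?\<Gamma>" using maximal_theory_Box_logic[OF normal_modal_logic_Grz \<Delta>] by simp
    then show "?\<alpha> \<in> \<Gamma>" using \<Gamma>(2) by blast
  next
    fix \<psi> assume "Box \<psi> \<in> \<Delta>"
    then have "Box (Box \<psi>) \<in> \<Delta>" by (rule Grz_4[OF \<Delta>])
    then have "Box (Imp ?\<alpha> (Box \<psi>)) \<in> \<Delta>"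
      by (rule Grz_Box_mono[OF \<Delta>]) (simp add: Grz_simps)
    then show "Box \<psi> \<in> \<Gamma>" using \<Gamma>(2) by blast
  qed
qed


section \<open>The finite model property\<close>

primrec subformulas :: "fm \<Rightarrow> fm set" where
  "subformulas (Var x) = {Var x}"
| "subformulas Bot = {Bot}"
| "subformulas Top = {Top}"
| "subformulas (Neg \<phi>) = insert (Neg \<phi>) (subformulas \<phi>)"
| "subformulas (And \<phi> \<psi>) = insert (And \<phi> \<psi>) (subformulas \<phi> \<union> subformulas \<psi>)"
| "subformulas (Or \<phi> \<psi>) = insert (Or \<phi> \<psi>) (subformulas \<phi> \<union> subformulas \<psi>)"
| "subformulas (Imp \<phi> \<psi>) = insert (Imp \<phi> \<psi>) (subformulas \<phi> \<union> subformulas \<psi>)"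
| "subformulas (Dia \<phi>) = insert (Dia \<phi>) (subformulas \<phi>)"
| "subformulas (Box \<phi>) = insert (Box \<phi>) (subformulas \<phi>)"

lemma finite_subformulas: "finite (subformulas \<phi>)"
  by (induction \<phi>) auto

lemma subformulas_refl: "\<phi> \<in> subformulas \<phi>"
  by (cases \<phi>) auto

text \<open>Strict successors gain a boxed formula, which makes the accessibility relation
  antisymmetric. The formulas \<open>\<box>(\<phi> \<longrightarrow> \<box>\<phi>)\<close> of the closure below are the ones gained.\<close>

definition box_order :: "fm set \<Rightarrow> fm set \<Rightarrow> bool" where
  "box_order a b \<longleftrightarrow> range Box \<inter> a \<subseteq> range Box \<inter> b \<and> (range Box \<inter> b \<subseteq> range Box \<inter> a \<longrightarrow> a = b)"

text \<open>\<open>Dia\<close> is primitive and is handled as the dual of \<open>Box\<close>, so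
  negated subformulas are boxed as well. The set need not be closed under subformulas, because only
  subformulas of \<chi> are evaluated in the truth lemma.\<close>

definition closure_fm :: "fm \<Rightarrow> fm set" where
  "closure_fm \<chi> = (let B = subformulas \<chi> \<union> Neg ` subformulas \<chi>
     in subformulas \<chi> \<union> Box ` B \<union> (\<lambda>\<phi>. Box (Imp \<phi> (Box \<phi>))) ` B)"

definition worlds :: "fm \<Rightarrow> fm set set" where
  "worlds \<chi> = (\<lambda>\<Delta>. \<Delta> \<inter> closure_fm \<chi>) ` Collect (maximal_theory Grz)"

lemma finite_worlds: "finite (worlds \<chi>)"
proof (rule finite_subset)
  show "worlds \<chi> \<subseteq> Pow (closure_fm \<chi>)" by (auto simp: worlds_def)
  show "finite (Pow (closure_fm \<chi>))" by (simp add: closure_fm_def finite_subformulas)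
qed

lemma box_order_refl: "box_order a a"
  by (simp add: box_order_def)

lemma box_order_trans: "box_order a b \<Longrightarrow> box_order b c \<Longrightarrow> box_order a c"
  unfolding box_order_def by blast

lemma box_order_antisym: "box_order a b \<Longrightarrow> box_order b a \<Longrightarrow> a = b"
  unfolding box_order_def by blast

text \<open>For the converse direction, reflexivity of the order puts \<phi> into \<Delta>. If
  \<open>Box \<phi>\<close> is missing, then so is \<open>Box (Imp \<phi> (Box \<phi>))\<close>,
  which the theory from \<open>Grz_successor\<close> contains. That theory therefore gains a box,
  the step is strict, and the antisymmetry clause of \<open>box_order\<close> holds
  vacuously.\<close>

lemma Box_iff_box_order:
  assumes \<Delta>: "maximal_theory Grz \<Delta>" and \<phi>: "\<phi> \<in> subformulas \<chi> \<union> Neg ` subformulas \<chi>"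
  shows "Box \<phi> \<in> \<Delta> \<longleftrightarrow>
    (\<forall>\<Gamma>. maximal_theory Grz \<Gamma> \<longrightarrow> box_order (\<Delta> \<inter> closure_fm \<chi>) (\<Gamma> \<inter> closure_fm \<chi>) \<longrightarrow> \<phi> \<in> \<Gamma>)"
    (is "_ \<longleftrightarrow> ?rhs")
proof
  have cl: "Box \<phi> \<in> closure_fm \<chi>" "Box (Imp \<phi> (Box \<phi>)) \<in> closure_fm \<chi>"
    using \<phi> unfolding closure_fm_def Let_def by blast+
  {
    assume "Box \<phi> \<in> \<Delta>"
    then show ?rhs using cl Grz_T unfolding box_order_def by blast
  next
    assume rhs: ?rhs
    show "Box \<phi> \<in> \<Delta>"
    proof (rule ccontr)
      assume nb: "Box \<phi> \<notin> \<Delta>"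
      have "\<phi> \<in> \<Delta>" using rhs \<Delta> box_order_refl by blast
      then have new: "Box (Imp \<phi> (Box \<phi>)) \<notin> \<Delta>"
        using Grz_T[OF \<Delta>] nb Grz_simps(6)[OF \<Delta>] by blast
      obtain \<Gamma> where \<Gamma>: "maximal_theory Grz \<Gamma>" "\<phi> \<notin> \<Gamma>" "Box (Imp \<phi> (Box \<phi>)) \<in> \<Gamma>"
        "\<And>\<psi>. Box \<psi> \<in> \<Delta> \<Longrightarrow> Box \<psi> \<in> \<Gamma>"
        using Grz_successor[OF \<Delta> nb] by blast
      have "box_order (\<Delta> \<inter> closure_fm \<chi>) (\<Gamma> \<inter> closure_fm \<chi>)"
        unfolding box_order_def using \<Gamma>(3,4) cl(2) new by blast
      then show False using rhs \<Gamma>(1,2) by blast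
    qed
  }
qed

lemma truth_lemma:
  assumes "subformulas \<phi> \<subseteq> subformulas \<chi>" and "maximal_theory Grz \<Delta>"
  shows "sat (worlds \<chi>) box_order (\<lambda>u a. Var u \<in> a) (\<Delta> \<inter> closure_fm \<chi>) \<phi> \<longleftrightarrow> \<phi> \<in> \<Delta>"
  using assms
proof (induction \<phi> arbitrary: \<Delta>)
  case (Var u)
  then show ?case by (auto simp: closure_fm_def)
next
  case (Dia \<phi>)
  have "\<phi> \<in> subformulas \<chi>" using Dia.prems(1) subformulas_refl[of \<phi>] by auto
  then have "Box (Neg \<phi>) \<in> \<Delta> \<longleftrightarrow> (\<forall>\<Gamma>. maximal_theory Grz \<Gamma> \<longrightarrow>
      box_order (\<Delta> \<inter> closure_fm \<chi>) (\<Gamma> \<inter> closure_fm \<chi>) \<longrightarrow> Neg \<phi> \<in> \<Gamma>)"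
    by (intro Box_iff_box_order[OF Dia.prems(2)]) auto
  then show ?case using Dia by (auto simp: worlds_def Grz_simps)
next
  case (Box \<phi>)
  have "\<phi> \<in> subformulas \<chi>" using Box.prems(1) subformulas_refl[of \<phi>] by auto
  then have "Box \<phi> \<in> \<Delta> \<longleftrightarrow> (\<forall>\<Gamma>. maximal_theory Grz \<Gamma> \<longrightarrow>
      box_order (\<Delta> \<inter> closure_fm \<chi>) (\<Gamma> \<inter> closure_fm \<chi>) \<longrightarrow> \<phi> \<in> \<Gamma>)"
    by (intro Box_iff_box_order[OF Box.prems(2)]) auto
  then show ?case using Box by (auto simp: worlds_def)
qed (auto simp: Grz_simps)


section \<open>Unravelling a finite poset into a full tree\<close>

context
  fixes W :: "'w set" and R :: "'w \<Rightarrow> 'w \<Rightarrow> bool" and e :: "nat \<Rightarrow> 'w"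
  assumes finite: "finite W"
    and refl: "\<And>x. R x x"
    and trans: "\<And>x y z. R x y \<Longrightarrow> R y z \<Longrightarrow> R x z"
    and antisym: "\<And>x y. R x y \<Longrightarrow> R y x \<Longrightarrow> x = y"
begin

definition rank :: "'w \<Rightarrow> nat" where
  "rank x = card {y \<in> W. R x y \<and> y \<noteq> x}"

text \<open>\<open>h\<close> is the height of tree still available above a node sent to
  \<open>x\<close>, and the invariant is that the rank of \<open>x\<close> is at most
  \<open>h\<close>. Child \<open>i\<close> goes to \<open>e i\<close> if that respects order and
  invariant; otherwise any admissible point serves, since every inner node of a full tree must have
  all its children.\<close>

definition step :: "'w \<Rightarrow> nat \<Rightarrow> nat \<Rightarrow> 'w" where
  "step x h i = (if R x (e i) \<and> rank (e i) < h then e i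
     else SOME y. y \<in> W \<and> R x y \<and> rank y < h)"

primrec unravel :: "'w \<Rightarrow> nat \<Rightarrow> nat list \<Rightarrow> 'w" where
  "unravel x h [] = x"
| "unravel x h (i # is) = unravel (step x h i) (h - 1) is"

lemma rank_less:
  assumes "y \<in> W" "R x y" "y \<noteq> x"
  shows "rank y < rank x"
  unfolding rank_def
proof (rule psubset_card_mono)
  show "finite {y \<in> W. R x y \<and> y \<noteq> x}" using finite by simp
  show "{z \<in> W. R y z \<and> z \<noteq> y} \<subset> {z \<in> W. R x z \<and> z \<noteq> x}"
    using assms trans antisym by blast
qed

lemma step_in:
  assumes x: "x \<in> W" "rank x \<le> h" and "0 < h" and "e i \<in> W"
  shows "step x h i \<in> W \<and> R x (step x h i) \<and> rank (step x h i) \<le> h - 1"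
proof -
  have "\<exists>y. y \<in> W \<and> R x y \<and> rank y < h"
  proof (cases "rank x < h")
    case True
    then show ?thesis using x refl by blast
  next
    \<comment> \<open>Here the rank equals \<open>h\<close>, so staying at \<open>x\<close> would
      break the invariant. As the rank is positive, there is a strict successor, of smaller
      rank.\<close>
    case False
    then have "rank x \<noteq> 0" using \<open>0 < h\<close> by linarith
    then obtain y where "y \<in> W" "R x y" "y \<noteq> x"
      unfolding rank_def by (metis (mono_tags, lifting) card.empty empty_Collect_eq)
    then show ?thesis using rank_less[of y x] x by auto
  qed
  then have "(SOME y. y \<in> W \<and> R x y \<and> rank y < h) \<in> W \<and> R x (SOME y. y \<in> W \<and> R x y \<and> rank y < h)
      \<and> rank (SOME y. y \<in> W \<and> R x y \<and> rank y < h) < h"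
    by (rule someI_ex)
  then show ?thesis using assms unfolding step_def by auto
qed

lemma unravel_in:
  assumes "x \<in> W" "rank x \<le> h" "length is \<le> h" "e ` set is \<subseteq> W"
  shows "unravel x h is \<in> W \<and> R x (unravel x h is) \<and> rank (unravel x h is) \<le> h - length is"
  using assms
proof (induction "is" arbitrary: x h)
  case Nil
  then show ?case using refl by simp
next
  case (Cons i "is")
  then have "step x h i \<in> W \<and> R x (step x h i) \<and> rank (step x h i) \<le> h - 1"
    by (intro step_in) auto
  then show ?case using Cons.IH[of "step x h i" "h - 1"] Cons.prems trans by auto
qed

lemma unravel_append: "unravel x h (is @ js) = unravel (unravel x h is) (h - length is) js"
  by (induction "is" arbitrary: x h) auto

text \<open>Back condition: a strict successor of the image of a node has smaller rank than that
  image, hence rank below the height left. So there is room for one more letter, and the index of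
  the successor leads to it in one step.\<close>

lemma bounded_morphism_unravel:
  assumes e: "e ` {..<n} = W" and x: "x \<in> W"
  shows "bounded_morphism (unravel x (rank x)) (tree n (rank x)) prefix W R"
proof -
  let ?f = "unravel x (rank x)"
  have in_W: "?f is \<in> W" "rank (?f is) \<le> rank x - length is" if "is \<in> tree n (rank x)" for "is"
    using unravel_in[of x "rank x" "is"] that x e by (auto simp: tree_def)
  have "R (?f is) (?f js)" if t: "is \<in> tree n (rank x)" "js \<in> tree n (rank x)" and "prefix is js"
    for "is" js
  proof -
    obtain ks where "js = is @ ks" using \<open>prefix is js\<close> by (auto simp: prefix_def)
    then have "length ks \<le> rank x - length is" "e ` set ks \<subseteq> W"
      using t(2) e by (auto simp: tree_def)
    then show ?thesis
      using unravel_in[of "?f is" "rank x - length is" ks] in_W[OF t(1)] \<open>js = is @ ks\<close>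
      by (simp add: unravel_append)
  qed
  moreover have "\<exists>js\<in>tree n (rank x). prefix is js \<and> ?f js = y"
    if t: "is \<in> tree n (rank x)" and y: "y \<in> W" "R (?f is) y" for "is" y
  proof (cases "y = ?f is")
    case True
    then show ?thesis using t by blast
  next
    case False
    obtain i where i: "i < n" "e i = y" using e y(1) by blast
    have less: "rank y < rank x - length is"
      using rank_less[OF y False] in_W(2)[OF t] by simp
    then have "?f (is @ [i]) = y" using y i by (simp add: unravel_append step_def)
    moreover have "is @ [i] \<in> tree n (rank x)" using t less i by (auto simp: tree_def)
    moreover have "prefix is (is @ [i])" by simp
    ultimately show ?thesis by blast
  qed
  ultimately show ?thesis using in_W(1) unfolding bounded_morphism_def by blast
qed

end

theorem Grz_complete:
  assumes "\<And>n d V. 0 < n \<Longrightarrow> sat (tree n d) prefix V [] \<chi>"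
  shows "\<chi> \<in> Grz"
  unfolding in_logic_iff[OF normal_modal_logic_Grz]
proof (intro allI impI)
  fix \<Delta> assume \<Delta>: "maximal_theory Grz \<Delta>"
  let ?x = "\<Delta> \<inter> closure_fm \<chi>" and ?V = "\<lambda>u (a :: fm set). Var u \<in> a"
  have x: "?x \<in> worlds \<chi>" using \<Delta> by (auto simp: worlds_def)
  obtain e where e: "e ` {..<card (worlds \<chi>)} = worlds \<chi>"
    using ex_bij_betw_nat_finite[OF finite_worlds[of \<chi>]]
    by (auto simp: bij_betw_def atLeast0LessThan)
  \<comment> \<open>The number of worlds becomes the branching number, for which the assumption
    demands positivity.\<close>
  have pos: "0 < card (worlds \<chi>)" using x finite_worlds by (auto simp: card_gt_0_iff)
  let ?f = "unravel (worlds \<chi>) box_order e ?x (rank (worlds \<chi>) box_order ?x)"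
  have "bounded_morphism ?f (tree (card (worlds \<chi>)) (rank (worlds \<chi>) box_order ?x)) prefix
      (worlds \<chi>) box_order"
    by (rule bounded_morphism_unravel[OF finite_worlds box_order_refl box_order_trans
          box_order_antisym e x])
  from sat_bounded_morphism[OF this, of "\<lambda>u is. ?V u (?f is)" ?V "[]" \<chi>]
  have "sat (worlds \<chi>) box_order ?V ?x \<chi>"
    using assms[OF pos] by (simp add: unravel.simps[OF finite_worlds box_order_refl box_order_trans
          box_order_antisym])
  then show "\<chi> \<in> \<Delta>" using truth_lemma \<Delta> by blast
qed


section \<open>Formulas in one variable on full trees\<close>

text \<open>All variables receive the same set \<open>Y\<close>. On \<open>Fm p\<close> this loses
  nothing, and it turns a formula into an operation on sets in which \<open>p\<close> is no longer
  mentioned.\<close>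

definition tval :: "fm \<Rightarrow> nat \<Rightarrow> nat \<Rightarrow> nat list set \<Rightarrow> bool" where
  "tval \<phi> n d Y \<longleftrightarrow> sat (tree n d) prefix (\<lambda>_ x. x \<in> Y) [] \<phi>"

lemma sat_Fm_eq_tval:
  assumes "\<phi> \<in> Fm p"
  shows "sat (tree n d) prefix V [] \<phi> \<longleftrightarrow> tval \<phi> n d {x. V p x}"
  unfolding tval_def using assms by (intro sat_cong_vars) (auto simp: Fm_def)

lemma Grz_iff: "\<phi> \<in> Grz \<longleftrightarrow> (\<forall>n>0. \<forall>d V. sat (tree n d) prefix V [] \<phi>)"
proof (intro iffI allI impI)
  show "sat (tree n d) prefix V [] \<phi>" if "\<phi> \<in> Grz" for n d V
    using that Nil_in_tree by (rule Grz_sound)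
qed (simp add: Grz_complete)

lemma equivalent_Grz_iff:
  assumes "\<phi> \<in> Fm p" "\<psi> \<in> Fm p"
  shows "equivalent Grz \<phi> \<psi> \<longleftrightarrow> (\<forall>n>0. \<forall>d Y. tval \<phi> n d Y \<longleftrightarrow> tval \<psi> n d Y)"
proof -
  have "equivalent Grz \<phi> \<psi> \<longleftrightarrow>
      (\<forall>n>0. \<forall>d (V :: nat \<Rightarrow> nat list \<Rightarrow> bool). tval \<phi> n d {x. V p x} \<longleftrightarrow> tval \<psi> n d {x. V p x})"
    unfolding equivalent_def Grz_iff sat_Iff
    by (simp add: sat_Fm_eq_tval[OF assms(1)] sat_Fm_eq_tval[OF assms(2)])
  also have "\<dots> \<longleftrightarrow> (\<forall>n>0. \<forall>d Y. tval \<phi> n d Y \<longleftrightarrow> tval \<psi> n d Y)"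
  proof (rule iffI; intro allI impI)
    fix n d :: nat and Y
    assume "\<forall>n>0. \<forall>d (V :: nat \<Rightarrow> nat list \<Rightarrow> bool).
        tval \<phi> n d {x. V p x} \<longleftrightarrow> tval \<psi> n d {x. V p x}" "0 < n"
    from this(1)[rule_format, OF this(2), of d "\<lambda>_ x. x \<in> Y"]
    show "tval \<phi> n d Y \<longleftrightarrow> tval \<psi> n d Y" by simp
  qed auto
  finally show ?thesis .
qed

definition tree_additive :: "fm \<Rightarrow> bool" where
  "tree_additive \<phi> \<longleftrightarrow>
     (\<forall>n>0. \<forall>d Y Z. tval \<phi> n d (Y \<union> Z) \<longleftrightarrow> tval \<phi> n d Y \<or> tval \<phi> n d Z)"

lemma sat_app_eq_tval:
  assumes "\<phi> \<in> Fm p"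
  shows "sat (tree n d) prefix V [] (app p \<phi> \<psi>) \<longleftrightarrow>
    tval \<phi> n d {x. sat (tree n d) prefix V x \<psi>}"
  by (simp add: sat_app[OF assms] tval_def)

text \<open>As \<open>p\<close> and \<open>q\<close> differ, a valuation can assign them arbitrary
  sets \<open>Y\<close> and \<open>Z\<close> independently.\<close>

lemma additive_Grz_iff:
  assumes "\<phi> \<in> Fm p" "p \<noteq> q"
  shows "additive Grz p q \<phi> \<longleftrightarrow> tree_additive \<phi>"
proof -
  have "additive Grz p q \<phi> \<longleftrightarrow>
      (\<forall>n>0. \<forall>d (V :: nat \<Rightarrow> nat list \<Rightarrow> bool). tval \<phi> n d ({x. V p x} \<union> {x. V q x}) \<longleftrightarrow>
        tval \<phi> n d {x. V p x} \<or> tval \<phi> n d {x. V q x})"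
    unfolding additive_def equivalent_def Grz_iff
    by (simp add: sat_app_eq_tval[OF assms(1)] Un_def)
  also have "\<dots> \<longleftrightarrow> tree_additive \<phi>"
    unfolding tree_additive_def
  proof (rule iffI; intro allI impI)
    fix n d :: nat and Y Z
    assume "\<forall>n>0. \<forall>d (V :: nat \<Rightarrow> nat list \<Rightarrow> bool). tval \<phi> n d ({x. V p x} \<union> {x. V q x}) \<longleftrightarrow>
        tval \<phi> n d {x. V p x} \<or> tval \<phi> n d {x. V q x}" "0 < n"
    from this(1)[rule_format, OF this(2), of d "\<lambda>u x. if u = p then x \<in> Y else x \<in> Z"]
    show "tval \<phi> n d (Y \<union> Z) \<longleftrightarrow> tval \<phi> n d Y \<or> tval \<phi> n d Z" using assms(2) by simp
  qed auto
  finally show ?thesis .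
qed

lemma normal_in_Grz_iff:
  assumes "\<phi> \<in> Fm p"
  shows "normal_in Grz p \<phi> \<longleftrightarrow> (\<forall>n>0. \<forall>d. \<not> tval \<phi> n d {})"
  unfolding normal_in_def equivalent_def Grz_iff
  by (simp add: sat_app_eq_tval[OF assms])

lemma tval_bounded_morphism:
  assumes "bounded_morphism f (tree n d) prefix (tree n' d') prefix" and "f [] = []"
    and "\<And>x. x \<in> tree n d \<Longrightarrow> x \<in> Y \<longleftrightarrow> f x \<in> Y'"
  shows "tval \<phi> n d Y \<longleftrightarrow> tval \<phi> n' d' Y'"
  unfolding tval_def
  using sat_bounded_morphism[OF assms(1), of "\<lambda>_ x. x \<in> Y" "\<lambda>_ x. x \<in> Y'" "[]" \<phi>] assms(2,3)
  by simp

lemma tval_cong: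
  assumes "\<And>x. x \<in> tree n d \<Longrightarrow> x \<in> Y \<longleftrightarrow> x \<in> Y'"
  shows "tval \<phi> n d Y \<longleftrightarrow> tval \<phi> n d Y'"
proof -
  have "bounded_morphism (\<lambda>x. x) (tree n d) prefix (tree n d) prefix"
    by (auto simp: bounded_morphism_def)
  from tval_bounded_morphism[OF this, of Y Y'] show ?thesis using assms by simp
qed

section \<open>Levels, collapses onto chains, and automorphisms\<close>

definition level :: "nat set \<Rightarrow> nat list set" where
  "level K = {xs. length xs \<in> K}"

lemma level_Un: "level (K \<union> K') = level K \<union> level K'"
  by (auto simp: level_def)

lemma ex_tree_level: "0 < n \<Longrightarrow> (\<exists>x\<in>tree n d. x \<in> level K) \<longleftrightarrow> (\<exists>k\<in>K. k \<le> d)"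
proof
  assume "0 < n" "\<exists>k\<in>K. k \<le> d"
  then obtain k where "k \<in> K" "k \<le> d" by blast
  then show "\<exists>x\<in>tree n d. x \<in> level K"
    using \<open>0 < n\<close> by (intro bexI[of _ "replicate k 0"]) (auto simp: tree_def level_def)
qed (auto simp: tree_def level_def)

text \<open>\<open>tree 1 d'\<close> is the chain of \<open>d' + 1\<close> points, and a node of
  depth \<open>k\<close> is sent to the point of depth \<open>h k\<close>. The back condition on
  depths suffices because every node can be prolonged, by zeros, to any larger depth up to
  \<open>d\<close>; this needs a nonempty alphabet.\<close>

lemma tval_level:
  assumes n: "0 < n" and h0: "h 0 = 0"
    and h_le: "\<And>k. k \<le> d \<Longrightarrow> h k \<le> d'"
    and h_mono: "\<And>j k. j \<le> k \<Longrightarrow> k \<le> d \<Longrightarrow> h j \<le> h k"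
    and h_back: "\<And>k m. k \<le> d \<Longrightarrow> h k \<le> m \<Longrightarrow> m \<le> d' \<Longrightarrow> \<exists>k'\<le>d. k \<le> k' \<and> h k' = m"
    and K: "\<And>k. k \<le> d \<Longrightarrow> k \<in> K \<longleftrightarrow> h k \<in> K'"
  shows "tval \<phi> n d (level K) \<longleftrightarrow> tval \<phi> 1 d' (level K')"
proof (rule tval_bounded_morphism)
  let ?f = "\<lambda>xs :: nat list. replicate (h (length xs)) (0 :: nat)"
  show "?f [] = []" by (simp add: h0)
  show "x \<in> level K \<longleftrightarrow> ?f x \<in> level K'" if "x \<in> tree n d" for x
    using that K by (auto simp: tree_def level_def)
  have "prefix (?f x) (?f y)" if "y \<in> tree n d" "prefix x y" for x y
  proof -
    have "h (length x) \<le> h (length y)"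
      using that h_mono by (simp add: tree_def prefix_length_le)
    then show ?thesis by (metis le_add_diff_inverse prefixI replicate_add)
  qed
  moreover have "\<exists>y\<in>tree n d. prefix x y \<and> ?f y = y'"
    if x: "x \<in> tree n d" and y': "y' \<in> tree 1 d'" "prefix (?f x) y'" for x y'
  proof -
    have y'_eq: "y' = replicate (length y') 0"
      using y'(1) by (intro replicate_eqI) (auto simp: tree_def)
    obtain k where k: "k \<le> d" "length x \<le> k" "h k = length y'"
      using h_back[of "length x" "length y'"] x y' prefix_length_le[OF y'(2)]
      by (auto simp: tree_def)
    let ?y = "x @ replicate (k - length x) 0"
    have "?y \<in> tree n d" using x k n by (auto simp: tree_def)
    moreover have "?f ?y = y'" using k y'_eq by simp
    moreover have "prefix x ?y" by simp
    ultimately show ?thesis by blast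
  qed
  moreover have "?f ` tree n d \<subseteq> tree 1 d'" using h_le by (auto simp: tree_def)
  ultimately show "bounded_morphism ?f (tree n d) prefix (tree 1 d') prefix"
    unfolding bounded_morphism_def by blast
qed

text \<open>An automorphism of the full tree exchanging the branches \<open>as\<close> and \<open>bs\<close>.\<close>

fun swap_branches :: "nat list \<Rightarrow> nat list \<Rightarrow> nat list \<Rightarrow> nat list" where
  "swap_branches (a # as) (b # bs) (x # xs) = transpose a b x # swap_branches as bs xs"
| "swap_branches as bs xs = xs"

lemma swap_branches_involutory [simp]: "swap_branches as bs (swap_branches as bs xs) = xs"
  by (induction as bs xs rule: swap_branches.induct) auto

lemma length_swap_branches [simp]: "length (swap_branches as bs xs) = length xs"
  by (induction as bs xs rule: swap_branches.induct) auto

lemma swap_branches_left: "length as = length bs \<Longrightarrow> swap_branches as bs as = bs"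
  by (induction as bs rule: list_induct2) auto

lemma prefix_swap_branches: "prefix xs ys \<Longrightarrow> prefix (swap_branches as bs xs) (swap_branches as bs ys)"
proof (induction as bs xs arbitrary: ys rule: swap_branches.induct)
  case (1 a as b bs x xs)
  then show ?case by (cases ys) auto
qed auto

lemma set_swap_branches:
  "set as \<subseteq> {..<n} \<Longrightarrow> set bs \<subseteq> {..<n} \<Longrightarrow> set xs \<subseteq> {..<n} \<Longrightarrow> set (swap_branches as bs xs) \<subseteq> {..<n}"
  by (induction as bs xs rule: swap_branches.induct) (auto simp: transpose_def)

text \<open>The swap acts letter by letter and is an involution, so the back condition follows from
  monotonicity: a node above the image of \<open>x\<close> is the image of its own swap, which lies
  above \<open>x\<close>.\<close>

lemma tval_singleton_cong:
  assumes y: "y \<in> tree n d" and z: "z \<in> tree n d" and "length y = length z"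
  shows "tval \<phi> n d {y} \<longleftrightarrow> tval \<phi> n d {z}"
proof (rule tval_bounded_morphism)
  let ?f = "swap_branches y z"
  have f: "?f x \<in> tree n d" if "x \<in> tree n d" for x
    using set_swap_branches[of y n z x] y z that by (auto simp: tree_def)
  moreover have "\<exists>v\<in>tree n d. prefix x v \<and> ?f v = v'"
    if "v' \<in> tree n d" "prefix (?f x) v'" for x v'
    using f[OF that(1)] prefix_swap_branches[OF that(2), of y z] by auto
  ultimately show "bounded_morphism ?f (tree n d) prefix (tree n d) prefix"
    unfolding bounded_morphism_def using prefix_swap_branches by blast
  show "?f [] = []" by (cases y; cases z) auto
  show "x \<in> {y} \<longleftrightarrow> ?f x \<in> {z}" for x
    using swap_branches_left[OF assms(3)] swap_branches_involutory[of y z] by (metis singleton_iff)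
qed


section \<open>Classification of the additive formulas\<close>

context
  fixes \<phi> :: fm
  assumes add: "tree_additive \<phi>"
begin

lemma tval_Un: "0 < n \<Longrightarrow> tval \<phi> n d (Y \<union> Z) \<longleftrightarrow> tval \<phi> n d Y \<or> tval \<phi> n d Z"
  using add by (simp add: tree_additive_def)

text \<open>The tree is finite and nodes outside it do not matter, so binary additivity with a false
  value at the empty set gives complete additivity.\<close>

lemma tval_iff_singleton:
  assumes n: "0 < n" and empty: "\<not> tval \<phi> n d {}"
  shows "tval \<phi> n d Y \<longleftrightarrow> (\<exists>y\<in>tree n d. y \<in> Y \<and> tval \<phi> n d {y})"
proof -
  have fin: "tval \<phi> n d F \<longleftrightarrow> (\<exists>y\<in>F. tval \<phi> n d {y})" if "finite F" for F
    using that
  proof (induction F)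
    case (insert y F)
    then show ?case using tval_Un[OF n, of d "{y}" F] by simp
  qed (simp add: empty)
  have "tval \<phi> n d Y \<longleftrightarrow> tval \<phi> n d (Y \<inter> tree n d)" by (rule tval_cong) simp
  also have "\<dots> \<longleftrightarrow> (\<exists>y\<in>Y \<inter> tree n d. tval \<phi> n d {y})"
    by (rule fin) (simp add: finite_tree)
  finally show ?thesis by blast
qed

text \<open>A level, unlike a single node in general, is a preimage under a collapse onto a
  chain.\<close>

lemma tval_singleton:
  assumes n: "0 < n" and empty: "\<not> tval \<phi> n d {}" and y: "y \<in> tree n d"
  shows "tval \<phi> n d {y} \<longleftrightarrow> tval \<phi> n d (level {length y})"
proof -
  have "tval \<phi> n d (level {length y}) \<longleftrightarrow>
      (\<exists>z\<in>tree n d. z \<in> level {length y} \<and> tval \<phi> n d {z})"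
    by (rule tval_iff_singleton[OF n empty])
  also have "\<dots> \<longleftrightarrow> tval \<phi> n d {y}"
  proof
    assume "\<exists>z\<in>tree n d. z \<in> level {length y} \<and> tval \<phi> n d {z}"
    then obtain z where "z \<in> tree n d" "length z = length y" "tval \<phi> n d {z}"
      by (auto simp: level_def)
    then show "tval \<phi> n d {y}" using tval_singleton_cong[OF _ y] by blast
  next
    assume "tval \<phi> n d {y}"
    then show "\<exists>z\<in>tree n d. z \<in> level {length y} \<and> tval \<phi> n d {z}"
      using y by (intro bexI[of _ y]) (simp_all add: level_def)
  qed
  finally show ?thesis by simp
qed

end

text \<open>The truth value at the root for the empty valuation on a point, for the root and for the top
  of the two-element chain, and for the middle of the three-element chain.\<close>

definition profile :: "fm \<Rightarrow> bool \<times> bool \<times> bool \<times> bool" where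
  "profile \<phi> = (tval \<phi> 1 0 {}, tval \<phi> 1 1 (level {0}), tval \<phi> 1 1 (level {1}), tval \<phi> 1 2 (level {1}))"

text \<open>By reflexivity the constant map onto one point is a bounded morphism.\<close>

lemma tval_empty:
  assumes "0 < n"
  shows "tval \<phi> n d {} \<longleftrightarrow> tval \<phi> 1 0 {}"
  using tval_level[OF assms, of "\<lambda>_. 0" d 0 "{}" "{}" \<phi>] by (auto simp: level_def)

text \<open>For \<open>d = 0\<close> the only node is root and leaf at once: the two-element chain
  with both points marked collapses onto it, and additivity splits the value. In the other cases the
  depths below \<open>k\<close>, equal to \<open>k\<close> and above \<open>k\<close> are merged
  into one point each.\<close>

lemma tval_level_profile:
  assumes n: "0 < n" and "tree_additive \<phi>" and "k \<le> d"
  shows "tval \<phi> n d (level {k}) \<longleftrightarrow>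
    (if d = 0 then tval \<phi> 1 1 (level {0}) \<or> tval \<phi> 1 1 (level {1})
     else if k = 0 then tval \<phi> 1 1 (level {0})
     else if k = d then tval \<phi> 1 1 (level {1})
     else tval \<phi> 1 2 (level {1}))"
proof -
  consider "d = 0" | "d \<noteq> 0" "k = 0" | "d \<noteq> 0" "k = d" | "0 < k" "k < d"
    using \<open>k \<le> d\<close> by linarith
  then show ?thesis
  proof cases
    case 1
    have "tval \<phi> 1 1 (level {0}) \<or> tval \<phi> 1 1 (level {1}) \<longleftrightarrow> tval \<phi> 1 1 (level ({0} \<union> {1}))"
      using tval_Un[OF assms(2), of 1] by (simp only: level_Un)
    also have "\<dots> \<longleftrightarrow> tval \<phi> 1 0 (level {0})"
      by (rule tval_level[where h = "\<lambda>_. 0"]) auto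
    also have "\<dots> \<longleftrightarrow> tval \<phi> n d (level {k})"
      using 1 \<open>k \<le> d\<close> n by (intro tval_level[where h = "\<lambda>_. 0", symmetric]) auto
    finally show ?thesis using 1 by simp
  next
    case 2
    let ?h = "\<lambda>j. if j = 0 then 0 else 1 :: nat"
    have "tval \<phi> n d (level {k}) \<longleftrightarrow> tval \<phi> 1 1 (level {0})"
    proof (rule tval_level[where h = ?h])
      fix j m assume "j \<le> d" "?h j \<le> m" "m \<le> 1"
      then show "\<exists>k'\<le>d. j \<le> k' \<and> ?h k' = m"
        \<comment> \<open>Depth \<open>j\<close> itself serves when it may stay in its class;
          \<open>d\<close> always lies in the topmost class.\<close>
        using 2 by (intro exI[of _ "if m = 0 then j else d"]) (auto split: if_splits)
    qed (use 2 n in auto)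
    then show ?thesis using 2 by simp
  next
    case 3
    let ?h = "\<lambda>j. if j < d then 0 else 1 :: nat"
    have "tval \<phi> n d (level {k}) \<longleftrightarrow> tval \<phi> 1 1 (level {1})"
    proof (rule tval_level[where h = ?h])
      fix j m assume "j \<le> d" "?h j \<le> m" "m \<le> 1"
      then show "\<exists>k'\<le>d. j \<le> k' \<and> ?h k' = m"
        using 3 by (intro exI[of _ "if m = 0 then j else d"]) (auto split: if_splits)
    qed (use 3 n in auto)
    then show ?thesis using 3 by simp
  next
    case 4
    let ?h = "\<lambda>j. if j < k then 0 else if j = k then 1 else 2 :: nat"
    have "tval \<phi> n d (level {k}) \<longleftrightarrow> tval \<phi> 1 2 (level {1})"
    proof (rule tval_level[where h = ?h])
      fix j m assume "j \<le> d" "?h j \<le> m" "m \<le> 2"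
      moreover from this have "m = 0 \<or> m = 1 \<or> m = 2" by linarith
      ultimately show "\<exists>k'\<le>d. j \<le> k' \<and> ?h k' = m"
        using 4 by (intro exI[of _ "if m = 0 then j else if m = 1 then k else d"])
          (auto split: if_splits)
    qed (use 4 n in auto)
    then show ?thesis using 4 by simp
  qed
qed

lemma equivalent_if_profile_eq:
  assumes Fm: "\<phi> \<in> Fm p" "\<psi> \<in> Fm p" and add: "tree_additive \<phi>" "tree_additive \<psi>"
    and eq: "profile \<phi> = profile \<psi>"
  shows "equivalent Grz \<phi> \<psi>"
  unfolding equivalent_Grz_iff[OF Fm]
proof (intro allI impI)
  fix n d :: nat and Y assume n: "0 < n"
  have empty: "tval \<phi> n d {} \<longleftrightarrow> tval \<psi> n d {}"
    using eq unfolding tval_empty[OF n] by (simp add: profile_def)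
  show "tval \<phi> n d Y \<longleftrightarrow> tval \<psi> n d Y"
  proof (cases "tval \<phi> n d {}")
    \<comment> \<open>Additivity with the empty set makes both formulas true for every
      \<open>Y\<close>.\<close>
    case True
    then show ?thesis
      using empty tval_Un[OF add(1) n, of d Y "{}"] tval_Un[OF add(2) n, of d Y "{}"] by simp
  next
    case False
    have "tval \<phi> n d {y} \<longleftrightarrow> tval \<psi> n d {y}" if y: "y \<in> tree n d" for y
    proof -
      have "length y \<le> d" using y by (simp add: tree_def)
      then show ?thesis
        using tval_singleton[OF add(1) n _ y] tval_singleton[OF add(2) n _ y] False empty
          tval_level_profile[OF n add(1)] tval_level_profile[OF n add(2)] eq
        by (simp add: profile_def)
    qed
    then show ?thesis
      using tval_iff_singleton[OF add(1) n False, of Y] tval_iff_singleton[OF add(2) n, of d Y]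
        False empty by simp
  qed
qed

text \<open>In \<open>B\<close> the lower two points of the three-element chain are merged, in
  \<open>C\<close> the upper two; additivity splits the preimage of the merged point.
  \<open>E\<close> is monotonicity from the empty set.\<close>

lemma profile_additive:
  assumes add: "tree_additive \<phi>"
  shows "profile \<phi> \<in> {(False, False, False, False), (False, True, False, False),
    (False, True, True, True), (True, True, True, True), (False, False, True, False),
    (False, True, True, False)}"
proof -
  have "tval \<phi> 1 2 (level ({0} \<union> {1})) \<longleftrightarrow> tval \<phi> 1 1 (level {0})"
  proof (rule tval_level[where h = "\<lambda>j. if j < 2 then 0 else 1"])
    fix j m :: nat assume "j \<le> 2" "(if j < 2 then 0 else 1) \<le> m" "m \<le> 1"
    then show "\<exists>k\<le>2. j \<le> k \<and> (if k < 2 then 0 else 1) = m"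
      by (intro exI[of _ "if m = 0 then j else 2"]) (auto split: if_splits)
  qed auto
  then have B: "tval \<phi> 1 2 (level {1}) \<Longrightarrow> tval \<phi> 1 1 (level {0})"
    using tval_Un[OF add] by (simp only: level_Un) simp
  have "tval \<phi> 1 2 (level ({1} \<union> {2})) \<longleftrightarrow> tval \<phi> 1 1 (level {1})"
  proof (rule tval_level[where h = "\<lambda>j. if j = 0 then 0 else 1"])
    fix j m :: nat assume "j \<le> 2" "(if j = 0 then 0 else 1) \<le> m" "m \<le> 1"
    then show "\<exists>k\<le>2. j \<le> k \<and> (if k = 0 then 0 else 1) = m"
      by (intro exI[of _ "if m = 0 then j else 2"]) (auto split: if_splits)
  qed auto
  then have C: "tval \<phi> 1 2 (level {1}) \<Longrightarrow> tval \<phi> 1 1 (level {1})"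
    using tval_Un[OF add] by (simp only: level_Un) simp
  have E: "tval \<phi> 1 d Y" if "tval \<phi> 1 0 {}" for d Y
    using that tval_empty[of 1 \<phi> d] tval_Un[OF add, of 1 d Y "{}"] by simp
  show ?thesis
  proof (cases "tval \<phi> 1 0 {}")
    case True
    then show ?thesis by (simp only: profile_def E) simp
  next
    case False
    then show ?thesis
      using B C by (cases "tval \<phi> 1 2 (level {1})"; cases "tval \<phi> 1 1 (level {0})";
          cases "tval \<phi> 1 1 (level {1})") (simp_all add: profile_def)
  qed
qed

section \<open>The six formulas and their profiles\<close>

lemma tval_six_formulas:
  "\<not> tval Bot n d Y"
  "tval Top n d Y"
  "tval (Var p) n d Y \<longleftrightarrow> [] \<in> Y"
  "tval (Dia (Var p)) n d Y \<longleftrightarrow> (\<exists>y\<in>tree n d. y \<in> Y)"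
  "tval (Or \<phi> \<psi>) n d Y \<longleftrightarrow> tval \<phi> n d Y \<or> tval \<psi> n d Y"
  by (simp_all add: tval_def)

text \<open>The maximal nodes are those of depth \<open>d\<close>, and each node lies below one of
  them: there the box descends to its argument, and conversely a leaf sees only itself.\<close>

lemma tval_Dia_Box:
  assumes n: "0 < n"
  shows "tval (Dia (Box (Var p))) n d Y \<longleftrightarrow> (\<exists>y\<in>tree n d. length y = d \<and> y \<in> Y)"
proof
  assume "tval (Dia (Box (Var p))) n d Y"
  then obtain y where y: "y \<in> tree n d" "\<And>z. z \<in> tree n d \<Longrightarrow> prefix y z \<Longrightarrow> z \<in> Y"
    by (auto simp: tval_def)
  let ?z = "y @ replicate (d - length y) 0"
  have "?z \<in> tree n d" "length ?z = d" using y(1) n by (auto simp: tree_def)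
  then show "\<exists>y\<in>tree n d. length y = d \<and> y \<in> Y" using y(2) by (meson prefixI)
next
  assume "\<exists>y\<in>tree n d. length y = d \<and> y \<in> Y"
  then obtain y where y: "y \<in> tree n d" "length y = d" "y \<in> Y" by blast
  then have "z = y" if "z \<in> tree n d" "prefix y z" for z
    using that by (auto simp: tree_def prefix_def)
  then show "tval (Dia (Box (Var p))) n d Y" using y by (auto simp: tval_def)
qed

lemma profile_six_formulas:
  "profile Bot = (False, False, False, False)"
  "profile (Var p) = (False, True, False, False)"
  "profile (Dia (Var p)) = (False, True, True, True)"
  "profile Top = (True, True, True, True)"
  "profile (Dia (Box (Var p))) = (False, False, True, False)"
  "profile (Or (Dia (Box (Var p))) (Var p)) = (False, True, True, False)"
proof -
  have "(\<exists>y\<in>tree 1 d. length y = d \<and> y \<in> level K) \<longleftrightarrow> d \<in> K" for d K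
    using ex_tree_level[of 1 d "{d} \<inter> K"] by (auto simp: level_def)
  then show
    "profile Bot = (False, False, False, False)"
    "profile (Var p) = (False, True, False, False)"
    "profile (Dia (Var p)) = (False, True, True, True)"
    "profile Top = (True, True, True, True)"
    "profile (Dia (Box (Var p))) = (False, False, True, False)"
    "profile (Or (Dia (Box (Var p))) (Var p)) = (False, True, True, False)"
    by (simp_all add: profile_def tval_six_formulas tval_Dia_Box ex_tree_level) (simp_all add: level_def)
qed

lemma six_formulas_Fm: "\<phi> \<in> six_formulas p \<Longrightarrow> \<phi> \<in> Fm p"
  by (auto simp: six_formulas_def Fm_def)

text \<open>Except for the two constants, each one says that \<open>Y\<close> meets a fixed set of
  nodes: the root, all nodes, the leaves, or the leaves and the root.\<close>

lemma six_formulas_additive: "\<phi> \<in> six_formulas p \<Longrightarrow> tree_additive \<phi>"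
  by (auto simp: six_formulas_def tree_additive_def tval_six_formulas tval_Dia_Box)

lemma profile_eq_if_equivalent:
  assumes "\<phi> \<in> Fm p" "\<psi> \<in> Fm p" "equivalent Grz \<phi> \<psi>"
  shows "profile \<phi> = profile \<psi>"
  using assms(3) unfolding equivalent_Grz_iff[OF assms(1,2)] by (simp add: profile_def)

lemma inj_on_profile: "inj_on profile (six_formulas p)"
  by (auto simp: six_formulas_def inj_on_def profile_six_formulas)

theorem theorem6p4:
  fixes p q :: nat
  assumes "p \<noteq> q"
  shows "card (six_formulas p) = 6
    \<and> (\<forall>\<phi>\<in>six_formulas p. \<phi> \<in> Fm p \<and> additive Grz p q \<phi>)
    \<and> pairwise (\<lambda>\<phi> \<psi>. \<not> equivalent Grz \<phi> \<psi>) (six_formulas p)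
    \<and> (\<forall>\<phi>\<in>Fm p. additive Grz p q \<phi> \<longrightarrow> (\<exists>\<psi>\<in>six_formulas p. equivalent Grz \<phi> \<psi>))
    \<and> {\<phi> \<in> six_formulas p. normal_in Grz p \<phi>} = six_formulas p - {Top}
    \<and> card {\<phi> \<in> six_formulas p. normal_in Grz p \<phi>} = 5"
proof -
  have card: "card (six_formulas p) = 6" "card (six_formulas p - {Top}) = 5"
    by (simp_all add: six_formulas_def insert_Diff_if)
  have additive: "\<forall>\<phi>\<in>six_formulas p. \<phi> \<in> Fm p \<and> additive Grz p q \<phi>"
    using six_formulas_Fm six_formulas_additive additive_Grz_iff[OF _ assms] by blast
  have distinct: "pairwise (\<lambda>\<phi> \<psi>. \<not> equivalent Grz \<phi> \<psi>) (six_formulas p)"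
    unfolding pairwise_def
    using profile_eq_if_equivalent six_formulas_Fm inj_on_profile[of p] by (meson inj_onD)
  have complete: "\<exists>\<psi>\<in>six_formulas p. equivalent Grz \<phi> \<psi>"
    if Fm: "\<phi> \<in> Fm p" and "additive Grz p q \<phi>" for \<phi>
  proof -
    have add: "tree_additive \<phi>" using that additive_Grz_iff[OF Fm assms] by simp
    \<comment> \<open>The six profiles left by \<open>profile_additive\<close> are precisely those
      of the six formulas.\<close>
    have "profile \<phi> \<in> profile ` six_formulas p"
      using profile_additive[OF add] by (simp add: six_formulas_def profile_six_formulas)
    then obtain \<psi> where "\<psi> \<in> six_formulas p" "profile \<phi> = profile \<psi>" by blast
    then show ?thesis
      using equivalent_if_profile_eq[OF Fm _ add] six_formulas_Fm six_formulas_additive by blast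
  qed
  have "normal_in Grz p \<phi> \<longleftrightarrow> \<phi> \<noteq> Top" if "\<phi> \<in> six_formulas p" for \<phi>
    unfolding normal_in_Grz_iff[OF six_formulas_Fm[OF that]] using that
    by (auto simp: six_formulas_def tval_six_formulas tval_Dia_Box)
  then have normal: "{\<phi> \<in> six_formulas p. normal_in Grz p \<phi>} = six_formulas p - {Top}" by blast
  show ?thesis unfolding normal using card additive distinct complete by blast
qed

end
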